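(* Let $d\ge 1$ and $\lambda>0$, and let $(\zeta_t^o)_{t\ge 0}$ be the continuous-time nearest-neighbors branching random walk on $\mathbb{Z}^d$ with parameter $\lambda$ initiated by a single particle at the origin. Then for all $x,y\in\mathbb{Z}_+^d$ and all $t\ge 0$, $$x\preceq y\ \Longrightarrow\ \zeta_t^o(y)\le_{st.}\zeta_t^o(x).$$
   Context: Continuous-time nearest-neighbors branching random walk with parameter $\lambda>0$: the particle system on $\mathbb{Z}^d$ in which each particle, independently, dies after an exponential time of intensity $1$ and, while alive, generates offspring at each of the $2d$ neighboring sites according to independent exponential inter-arrival times of intensity $\lambda$. Formally, $\zeta_t=(\zeta_t(x):x\in\mathbb{Z}^d)$ is the Markov process on configurations $\zeta:\mathbb{Z}^d\to\{0,1,2,\dots\}$ with $\sum_x\zeta(x)<\infty$ and transition rates: $\zeta_t(x)\to\zeta_t(x)-1$ at rate $\zeta_t(x)$, and $\zeta_t(x)\to\zeta_t(x)+1$ at rate $\lambda\sum_{y:|y-x|=1}\zeta_t(y)$, where $|\cdot|$ is the $L^1$-distance. $\zeta_t(x)$ is the number of particles at $x$ at time $t$. $\mathbb{Z}_+^d$ is the set of points of $\mathbb{Z}^d$ with all coordinates $\ge 0$. For $x,y\in\mathbb{Z}_+^d$, $x\preceq y$ means $x_i\le y_i$ for all $i=1,\dots,d$. For random variables $X,Y$ with cumulative distribution functions $F,G$, $X\le_{st.}Y$ means $F(s)\ge G(s)$ for all $s$. *)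

theory Defs
  imports "HOL-Probability.Probability" "HOL-Library.Multiset"
begin

text \<open>
  A configuration is a map from the lattice to the naturals with finite total mass, that is, a
  finite multiset of sites; \<open>count \<zeta> x\<close> is the number of particles at \<open>x\<close>. The dimension is
  \<open>CARD('d)\<close>.
\<close>

type_synonym 'd config = "(int ^ 'd) multiset"

definition l1_dist :: "int ^ 'd \<Rightarrow> int ^ 'd \<Rightarrow> int" where
  "l1_dist x y = (\<Sum>i\<in>UNIV. \<bar>x $ i - y $ i\<bar>)"

text \<open>
  Each of the two outer sums has at most one term: the site of the particle that dies,
  respectively the site where a particle is born.
\<close>

definition jump_rate :: "real \<Rightarrow> ('d::finite) config \<Rightarrow> 'd config \<Rightarrow> real" where
  "jump_rate lam \<zeta> \<zeta>' =
     (\<Sum>x | \<zeta> = add_mset x \<zeta>'. real (count \<zeta> x)) +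
     (\<Sum>x | \<zeta>' = add_mset x \<zeta>. lam * (\<Sum>y | l1_dist y x = 1. real (count \<zeta> y)))"

text \<open>Only finitely many terms are non-zero, so this infinite sum is a finite one.\<close>

definition total_jump_rate :: "real \<Rightarrow> ('d::finite) config \<Rightarrow> real" where
  "total_jump_rate lam \<zeta> = (\<Sum>\<^sub>\<infinity>\<zeta>'\<in>- {\<zeta>}. jump_rate lam \<zeta> \<zeta>')"

definition markov_semigroup :: "(real \<Rightarrow> 's \<Rightarrow> 's pmf) \<Rightarrow> bool" where
  "markov_semigroup P \<longleftrightarrow>
     (\<forall>a. P 0 a = return_pmf a) \<and>
     (\<forall>s\<ge>0. \<forall>t\<ge>0. \<forall>a. P (s + t) a = bind_pmf (P s a) (P t))"

definition has_jump_rates ::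
  "(real \<Rightarrow> 's \<Rightarrow> 's pmf) \<Rightarrow> ('s \<Rightarrow> 's \<Rightarrow> real) \<Rightarrow> ('s \<Rightarrow> real) \<Rightarrow> bool" where
  "has_jump_rates P q r \<longleftrightarrow>
     (\<forall>a b. a \<noteq> b \<longrightarrow> ((\<lambda>h. pmf (P h a) b / h) \<longlongrightarrow> q a b) (at_right 0)) \<and>
     (\<forall>a. ((\<lambda>h. (1 - pmf (P h a) a) / h) \<longlongrightarrow> r a) (at_right 0))"

definition past :: "'w measure \<Rightarrow> (real \<Rightarrow> 'w \<Rightarrow> 's) \<Rightarrow> real \<Rightarrow> 'w measure" where
  "past M Z s = sigma (space M) {Z u -` B \<inter> space M | u B. 0 \<le> u \<and> u \<le> s}"

definition markov_process ::
  "'w measure \<Rightarrow> (real \<Rightarrow> 'w \<Rightarrow> 's) \<Rightarrow> (real \<Rightarrow> 's \<Rightarrow> 's pmf) \<Rightarrow> bool" where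
  "markov_process M Z P \<longleftrightarrow>
     prob_space M \<and>
     (\<forall>t\<ge>0. Z t \<in> measurable M (count_space UNIV)) \<and>
     (\<forall>s\<ge>0. \<forall>t\<ge>0. \<forall>b. AE \<omega> in M.
        real_cond_exp M (past M Z s) (indicator {\<omega> \<in> space M. Z (s + t) \<omega> = b}) \<omega>
          = pmf (P t (Z s \<omega>)) b)"

text \<open>
  The transition probabilities are honest (a \<open>pmf\<close> has mass one), so no mass is lost to explosion.
  Path regularity is not required.
\<close>

definition branching_random_walk ::
  "real \<Rightarrow> 'w measure \<Rightarrow> (real \<Rightarrow> 'w \<Rightarrow> ('d::finite) config) \<Rightarrow> bool" where
  "branching_random_walk lam M Z \<longleftrightarrow>
     (\<exists>P. markov_semigroup P \<and> has_jump_rates P (jump_rate lam) (total_jump_rate lam) \<and>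
          markov_process M Z P)"

definition stochastically_le ::
  "'a measure \<Rightarrow> ('a \<Rightarrow> real) \<Rightarrow> 'b measure \<Rightarrow> ('b \<Rightarrow> real) \<Rightarrow> bool" where
  "stochastically_le M X N Y \<longleftrightarrow>
     (\<forall>s. cdf (distr M borel X) s \<ge> cdf (distr N borel Y) s)"

end

theory Submission
  imports Defs
begin

text \<open>
  The proof is a reflection principle for the branching random walk. Suppose that \<open>y\<close> is the mirror
  image of \<open>x\<close> in a hyperplane orthogonal to a coordinate axis, with \<open>x\<close> and the origin on the same
  side. Run two copies of the process from the origin. They agree as long as nothing reaches the
  hyperplane; from then on, the part of the population that descends from the crossing is made to
  evolve in the second copy as the mirror image of that in the first. With sites on the
  hyperplane, the crossing happens at such a site. If the hyperplane runs halfway between sites, it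
  happens when a particle gives birth at its own mirror image; parent and child together are then
  invariant under the reflection, so that both can be treated as mirrored from that moment on. The
  particles that are not mirrored never leave the side of the origin. Hence the particles of the
  second copy at \<open>y\<close> are mirror images of particles of the first copy at \<open>x\<close>, and there are at most
  as many. Any \<open>y\<close> above \<open>x\<close> is reached from \<open>x\<close> by changing one coordinate at a time, and each
  change is such a reflection.

  The process is given only through its transition probabilities and their derivatives at time
  zero. The coupling is therefore carried out on the level of generators. By
  \<open>semigroup_apply_backward_equation\<close>, bounded observables solve the backward equation. A
  maximum principle, \<open>stochastic_comparison\<close>, turns an inequality between the generators at minimal
  related pairs into an inequality between the semigroups at all times; the unbounded rates are
  controlled by a Lyapunov function with finite level sets, the number of particles weighted by
  their distance to the origin. The inequality for the mirror relation is
  \<open>mirror_coupled_generator_mono\<close>. The maximum principle compares two different observables of the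
  same semigroup, here the occupation numbers at \<open>x\<close> and at \<open>y\<close>.
\<close>

section \<open>Markov semigroups on a discrete space\<close>

definition semigroup_apply :: "(real \<Rightarrow> 's \<Rightarrow> 's pmf) \<Rightarrow> ('s \<Rightarrow> real) \<Rightarrow> real \<Rightarrow> 's \<Rightarrow> real" where
  "semigroup_apply P f t a = measure_pmf.expectation (P t a) f"

definition generator :: "('s \<Rightarrow> 's \<Rightarrow> real) \<Rightarrow> ('s \<Rightarrow> real) \<Rightarrow> 's \<Rightarrow> real" where
  "generator q h a = (\<Sum>b | b \<noteq> a \<and> q a b \<noteq> 0. q a b * (h b - h a))"

lemma integrable_pmf_bounded:
  fixes p :: "'s pmf" and f :: "'s \<Rightarrow> real"
  assumes "\<And>b. \<bar>f b\<bar> \<le> c"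
  shows "integrable p f"
  by (rule measure_pmf.integrable_const_bound[where B = c]) (use assms in auto)

lemma semigroup_apply_bounds:
  assumes "\<And>b. 0 \<le> f b" "\<And>b. f b \<le> 1"
  shows "0 \<le> semigroup_apply P f t a" "semigroup_apply P f t a \<le> 1"
proof -
  show "0 \<le> semigroup_apply P f t a"
    unfolding semigroup_apply_def using assms by simp
  have "integrable (P t a) f"
    by (rule integrable_pmf_bounded[where c = 1]) (use assms in \<open>simp add: abs_of_nonneg\<close>)
  then show "semigroup_apply P f t a \<le> 1"
    unfolding semigroup_apply_def by (intro measure_pmf.integral_le_const) (use assms in auto)
qed

lemma semigroup_apply_add:
  assumes P: "markov_semigroup P" and f: "\<And>b. 0 \<le> f b" "\<And>b. f b \<le> 1"
    and "0 \<le> s" "0 \<le> t"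
  shows "semigroup_apply P f (s + t) a = measure_pmf.expectation (P s a) (semigroup_apply P f t)"
proof -
  have "P (s + t) a = bind_pmf (P s a) (P t)"
    using P assms unfolding markov_semigroup_def by auto
  moreover have "measure_pmf.expectation (bind_pmf (P s a) (P t)) f
      = measure_pmf.expectation (P s a) (\<lambda>b. measure_pmf.expectation (P t b) f)"
    unfolding measure_pmf_bind
    using f measurable_measure_pmf[of "P t"]
    by (intro integral_bind[where K = "count_space UNIV" and B' = 1 and B = 1])
       (auto simp: measure_pmf.emeasure_space_1 abs_of_nonneg)
  ultimately show ?thesis
    unfolding semigroup_apply_def by simp
qed

text \<open>
  The first-order expansion of \<open>P\<^sub>h u(a)\<close>: only the jumps into \<open>F\<close> are kept, and a function with
  values in \<open>[0,1]\<close> changes by at most one on the event that the jump leads elsewhere. With \<open>F\<close>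
  empty this bounds the modulus of continuity in time, and with \<open>F\<close> the set of possible jumps it
  gives the derivative.
\<close>

lemma expectation_increment_le:
  fixes p :: "'s pmf" and u :: "'s \<Rightarrow> real"
  assumes u: "\<And>b. 0 \<le> u b" "\<And>b. u b \<le> 1" and F: "finite F" "a \<notin> F"
  shows "\<bar>measure_pmf.expectation p u - u a - (\<Sum>b\<in>F. pmf p b * (u b - u a))\<bar>
           \<le> 1 - pmf p a - (\<Sum>b\<in>F. pmf p b)"
proof -
  define G where "G = insert a F"
  have u1: "\<bar>u b - u a\<bar> \<le> 1" for b using u[of a] u[of b] by linarith
  have int [simp]: "integrable p u" "integrable p (\<lambda>b. u b - u a)"
    using integrable_pmf_bounded[of u 1 p] integrable_pmf_bounded[of "\<lambda>b. u b - u a" 1 p] u u1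
    by (auto simp: abs_le_iff intro: order_trans[of _ 0])
  have G: "finite G" using F by (simp add: G_def)
  have intI: "integrable p (\<lambda>b. indicator A b * (u b - u a))" for A
    by (rule integrable_pmf_bounded[where c = 1]) (use u1 in \<open>auto simp: indicator_def\<close>)
  have "measure_pmf.expectation p u - u a = measure_pmf.expectation p (\<lambda>b. u b - u a)"
    by simp
  also have "\<dots> = measure_pmf.expectation p
      (\<lambda>b. indicator G b * (u b - u a) + indicator (- G) b * (u b - u a))"
    by (rule Bochner_Integration.integral_cong) (auto simp: indicator_def)
  also have "\<dots> = measure_pmf.expectation p (\<lambda>b. indicator G b * (u b - u a))
      + measure_pmf.expectation p (\<lambda>b. indicator (- G) b * (u b - u a))"
    by (rule Bochner_Integration.integral_add[OF intI intI])
  also have "measure_pmf.expectation p (\<lambda>b. indicator G b * (u b - u a))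
      = (\<Sum>b\<in>G. pmf p b * (u b - u a))"
    by (subst integral_measure_pmf[OF G]) (auto simp: indicator_def split: if_splits)
  also have "\<dots> = (\<Sum>b\<in>F. pmf p b * (u b - u a))"
    using F by (simp add: G_def)
  finally have eq: "measure_pmf.expectation p u - u a - (\<Sum>b\<in>F. pmf p b * (u b - u a))
      = measure_pmf.expectation p (\<lambda>b. indicator (- G) b * (u b - u a))" by simp
  have "\<bar>measure_pmf.expectation p (\<lambda>b. indicator (- G) b * (u b - u a))\<bar>
      \<le> measure_pmf.expectation p (\<lambda>b. \<bar>indicator (- G) b * (u b - u a)\<bar>)"
    by (rule integral_abs_bound)
  also have "\<dots> \<le> measure_pmf.expectation p (indicator (- G))"
    by (rule integral_mono)
      (use u1 intI in \<open>auto simp: indicator_def intro!: integrable_pmf_bounded[where c = 1]\<close>)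
  also have "\<dots> = measure p (- G)"
    by simp
  also have "\<dots> = 1 - measure p G"
    using measure_pmf.prob_compl[of G p] by (simp add: Compl_eq_Diff_UNIV)
  also have "measure p G = pmf p a + (\<Sum>b\<in>F. pmf p b)"
    using F G by (simp add: measure_measure_pmf_finite G_def)
  finally show ?thesis using eq by simp
qed

lemma semigroup_apply_continuous:
  assumes P: "markov_semigroup P" and q: "has_jump_rates P q r"
    and f: "\<And>b. 0 \<le> f b" "\<And>b. f b \<le> 1"
  shows "continuous_on {0..} (\<lambda>t. semigroup_apply P f t a)"
proof -
  have inc: "\<bar>semigroup_apply P f (h + t) a - semigroup_apply P f t a\<bar> \<le> 1 - pmf (P h a) a"
    if "0 \<le> h" "0 \<le> t" for h t
    using expectation_increment_le[of "semigroup_apply P f t" "{}" a "P h a"]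
      semigroup_apply_add[OF P f that] semigroup_apply_bounds[of f, OF f] by simp
  have "((\<lambda>h. (1 - pmf (P h a) a) / h * h) \<longlongrightarrow> r a * 0) (at_right 0)"
    by (intro tendsto_mult tendsto_ident_at) (use q in \<open>auto simp: has_jump_rates_def\<close>)
  then have lim: "((\<lambda>h. 1 - pmf (P h a) a) \<longlongrightarrow> 0) (at_right 0)"
    by (rule Lim_transform_eventually[THEN tendsto_eq_rhs])
      (auto simp: eventually_at_right_field intro: exI[of _ 1])
  show ?thesis
    unfolding continuous_on_iff
  proof (intro ballI allI impI)
    fix t e :: real assume t: "t \<in> {0..}" and e: "0 < e"
    from order_tendstoD(2)[OF lim e] obtain d where d: "d > 0"
      "\<And>h. 0 < h \<Longrightarrow> h < d \<Longrightarrow> 1 - pmf (P h a) a < e"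
      unfolding eventually_at_right_field by auto
    have *: "\<bar>semigroup_apply P f t' a - semigroup_apply P f s' a\<bar> < e"
      if "0 \<le> s'" "s' \<le> t'" "t' - s' < d" for s' t'
      using inc[of "t' - s'" s'] d(2)[of "t' - s'"] that e by (cases "s' = t'") auto
    show "\<exists>d>0. \<forall>t'\<in>{0..}. dist t' t < d \<longrightarrow> dist (semigroup_apply P f t' a) (semigroup_apply P f t a) < e"
    proof (intro exI[of _ d] conjI ballI impI \<open>d > 0\<close>)
      fix t' :: real assume "t' \<in> {0..}" "dist t' t < d"
      then show "dist (semigroup_apply P f t' a) (semigroup_apply P f t a) < e"
        using *[of t t'] *[of t' t] t
        by (cases "t \<le> t'") (auto simp: dist_real_def abs_minus_commute)
    qed
  qed
qed

text \<open>
  In the difference quotient of \<open>t \<mapsto> P\<^sub>t f(a)\<close> the jumps from \<open>a\<close> into the support of \<open>q(a,\<cdot>)\<close> converge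
  term by term. The remaining mass divided by \<open>h\<close> tends to zero because the total rate \<open>r(a)\<close> is
  the sum of the individual rates. The chain moves first by the small time \<open>h\<close> and then by \<open>t\<close>, so
  the generator acts on \<open>P\<^sub>t f\<close> and the equation is the backward one.
\<close>

lemma semigroup_apply_backward_equation:
  assumes P: "markov_semigroup P" and q: "has_jump_rates P q r"
    and fin: "finite {b. b \<noteq> a \<and> q a b \<noteq> 0}"
    and r: "r a = (\<Sum>b | b \<noteq> a \<and> q a b \<noteq> 0. q a b)"
    and f: "\<And>b. 0 \<le> f b" "\<And>b. f b \<le> 1" and t: "0 \<le> t"
  shows "((\<lambda>t. semigroup_apply P f t a) has_real_derivative generator q (semigroup_apply P f t) a)
           (at_right t)"
proof -
  define F where "F = {b. b \<noteq> a \<and> q a b \<noteq> 0}"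
  define u where "u = semigroup_apply P f t"
  have F: "finite F" "a \<notin> F" using fin by (auto simp: F_def)
  have u: "0 \<le> u b" "u b \<le> 1" for b
    using semigroup_apply_bounds[of f, OF f] by (auto simp: u_def)
  have limq: "((\<lambda>h. pmf (P h a) b / h) \<longlongrightarrow> q a b) (at_right 0)" if "b \<in> F" for b
    using q that unfolding has_jump_rates_def F_def by auto
  have limr: "((\<lambda>h. (1 - pmf (P h a) a) / h) \<longlongrightarrow> r a) (at_right 0)"
    using q unfolding has_jump_rates_def by auto
  define S where "S h = (\<Sum>b\<in>F. pmf (P h a) b / h * (u b - u a))" for h
  define E where "E h = (1 - pmf (P h a) a) / h - (\<Sum>b\<in>F. pmf (P h a) b / h)" for h
  have S: "(S \<longlongrightarrow> generator q u a) (at_right 0)"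
    unfolding S_def generator_def F_def[symmetric]
    by (intro tendsto_sum tendsto_mult limq tendsto_const)
  have "(E \<longlongrightarrow> r a - (\<Sum>b\<in>F. q a b)) (at_right 0)"
    unfolding E_def by (intro tendsto_diff tendsto_sum limq limr)
  then have E: "(E \<longlongrightarrow> 0) (at_right 0)"
    using r by (simp add: F_def)
  have bound: "\<forall>\<^sub>F h in at_right 0. norm ((semigroup_apply P f (t + h) a - u a) / h - S h) \<le> E h"
    unfolding eventually_at_right_field
  proof (intro exI[of _ 1] conjI allI impI)
    fix h :: real assume h: "0 < h"
    have "\<bar>semigroup_apply P f (t + h) a - u a - (\<Sum>b\<in>F. pmf (P h a) b * (u b - u a))\<bar>
         \<le> 1 - pmf (P h a) a - (\<Sum>b\<in>F. pmf (P h a) b)"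
      using expectation_increment_le[where p = "P h a", OF u F(1) F(2)] semigroup_apply_add[where s = h and t = t and a = a, OF P f] h t
      by (simp add: u_def add.commute)
    then have "\<bar>semigroup_apply P f (t + h) a - u a - (\<Sum>b\<in>F. pmf (P h a) b * (u b - u a))\<bar> / h
         \<le> (1 - pmf (P h a) a - (\<Sum>b\<in>F. pmf (P h a) b)) / h"
      using h by (intro divide_right_mono) auto
    also have "\<dots> = E h"
      by (simp add: E_def diff_divide_distrib sum_divide_distrib)
    also have "\<bar>semigroup_apply P f (t + h) a - u a - (\<Sum>b\<in>F. pmf (P h a) b * (u b - u a))\<bar> / h
        = \<bar>(semigroup_apply P f (t + h) a - u a - (\<Sum>b\<in>F. pmf (P h a) b * (u b - u a))) / h\<bar>"
      using h by simp
    also have "\<dots> = norm ((semigroup_apply P f (t + h) a - u a) / h - S h)"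
      by (simp add: S_def diff_divide_distrib sum_divide_distrib)
    finally show "norm ((semigroup_apply P f (t + h) a - u a) / h - S h) \<le> E h" .
  qed simp
  have "((\<lambda>h. (semigroup_apply P f (t + h) a - u a) / h - S h) \<longlongrightarrow> 0) (at_right 0)"
    using Lim_null_comparison[OF bound E] .
  from tendsto_add[OF this S]
  have "((\<lambda>h. (semigroup_apply P f (t + h) a - u a) / h) \<longlongrightarrow> generator q u a) (at_right 0)"
    by simp
  moreover have "filterlim (\<lambda>y. y - t) (at_right 0) (at_right t)"
    by (subst at_right_to_0) (simp add: filterlim_filtermap filterlim_ident)
  ultimately have "((\<lambda>y. (semigroup_apply P f (t + (y - t)) a - u a) / (y - t)) \<longlongrightarrow> generator q u a)
      (at_right t)"
    by (rule filterlim_compose)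
  then show ?thesis
    unfolding has_field_derivative_iff u_def by simp
qed

section \<open>A maximum principle for coupled generators\<close>

text \<open>
  At the infimum \<open>\<tau>\<close> of the times at which some component is negative, all components are still
  nonnegative by continuity; the positive ones stay so for a while by continuity and the vanishing
  ones by hypothesis. There are finitely many of them, so this contradicts the choice of \<open>\<tau>\<close>.
\<close>

lemma nonneg_if_nondecreasing_at_zeros:
  fixes w :: "real \<Rightarrow> 'p \<Rightarrow> real"
  assumes S: "finite S"
    and cont: "\<And>p. p \<in> S \<Longrightarrow> continuous_on {0..} (\<lambda>t. w t p)"
    and init: "\<And>p. p \<in> S \<Longrightarrow> 0 \<le> w 0 p"
    and touch: "\<And>t p. 0 \<le> t \<Longrightarrow> p \<in> S \<Longrightarrow> w t p = 0 \<Longrightarrow> (\<And>p'. p' \<in> S \<Longrightarrow> 0 \<le> w t p') \<Longrightarrow>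
        \<forall>\<^sub>F s in at_right t. 0 \<le> w s p"
    and "p \<in> S" "0 \<le> t"
  shows "0 \<le> w t p"
proof (rule ccontr)
  assume neg: "\<not> 0 \<le> w t p"
  define N where "N = {t. 0 \<le> t \<and> (\<exists>p\<in>S. w t p < 0)}"
  define \<tau> where "\<tau> = Inf N"
  have "t \<in> N" using neg assms(5,6) by (auto simp: N_def not_le)
  have bdd: "bdd_below N" by (rule bdd_belowI[of _ 0]) (auto simp: N_def)
  have \<tau>: "0 \<le> \<tau>" unfolding \<tau>_def
    by (rule cInf_greatest) (use \<open>t \<in> N\<close> in \<open>auto simp: N_def\<close>)
  have before: "0 \<le> w s p'" if "0 \<le> s" "s < \<tau>" "p' \<in> S" for s p'
    using cInf_lower[OF _ bdd, of s] that unfolding \<tau>_def[symmetric] by (force simp: N_def)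
  have at: "0 \<le> w \<tau> p'" if p': "p' \<in> S" for p'
  proof (cases "\<tau> = 0")
    case True
    then show ?thesis using init p' by simp
  next
    case False
    have lim: "((\<lambda>s. w s p') \<longlongrightarrow> w \<tau> p') (at \<tau> within {0..<\<tau>})"
      by (rule tendsto_within_subset[where S = "{0..}"])
         (use cont[OF p'] \<tau> in \<open>auto simp: continuous_on_def\<close>)
    have "at \<tau> within {0..<\<tau>} \<noteq> bot"
      using False \<tau> by (simp add: at_within_eq_bot_iff)
    then show ?thesis
      by (intro tendsto_lowerbound[OF lim]) (use before p' in \<open>auto simp: eventually_at_filter\<close>)
  qed
  have "\<forall>\<^sub>F s in at_right \<tau>. 0 \<le> w s p'" if p': "p' \<in> S" for p'
  proof (cases "w \<tau> p' = 0")
    case True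
    then show ?thesis using touch[OF \<tau> p'] at by blast
  next
    case False
    have "((\<lambda>s. w s p') \<longlongrightarrow> w \<tau> p') (at_right \<tau>)"
      by (rule tendsto_within_subset[where S = "{0..}"])
         (use cont[OF p'] \<tau> in \<open>auto simp: continuous_on_def\<close>)
    from order_tendstoD(1)[OF this, of 0] show ?thesis
      using at[OF p'] False by (auto elim: eventually_mono)
  qed
  then have "\<forall>\<^sub>F s in at_right \<tau>. \<forall>p'\<in>S. 0 \<le> w s p'"
    using S by (simp add: eventually_ball_finite)
  then obtain d where d: "\<tau> < d" "\<And>s p'. \<tau> < s \<Longrightarrow> s < d \<Longrightarrow> p' \<in> S \<Longrightarrow> 0 \<le> w s p'"
    unfolding eventually_at_right_field by auto
  have "d \<le> \<tau>"
    unfolding \<tau>_def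
  proof (rule cInf_greatest)
    show "N \<noteq> {}" using \<open>t \<in> N\<close> by auto
    fix s assume s: "s \<in> N"
    have "\<not> s < \<tau>" "s \<noteq> \<tau>" "\<not> (\<tau> < s \<and> s < d)"
      using s before at d(2) by (auto simp: N_def) (meson not_le)+
    then show "d \<le> s" by linarith
  qed
  then show False using d(1) by simp
qed

lemma generator_affine:
  "generator q (\<lambda>b. h b + c * g b) a = generator q h a + c * generator q g a"
  unfolding generator_def
  by (simp add: sum_distrib_left sum.distrib[symmetric] algebra_simps)

text \<open>
  The hypothesis on \<open>rel\<close> says on the level of generators that two copies of the chain can be coupled
  so that they jump between related pairs: where \<open>h1 a - h2 b\<close> is minimal among related pairs, no
  such jump can lower it, so the coupled generator is nonnegative there.

  The difference \<open>P\<^sub>t f1(a) - P\<^sub>t f2(b)\<close> solves a linear evolution equation on related pairs, and the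
  claim is that it stays nonnegative. Adding \<open>e exp(L t) (1 + \<Phi>(a) + \<Phi>(b))\<close> serves two
  purposes: outside a finite set of pairs the sum is nonnegative trivially, and where it touches
  zero its derivative is strictly positive, since \<open>\<Phi>\<close> grows at rate at most \<open>L\<close>. Finally
  \<open>e\<close> tends to zero.
\<close>

lemma stochastic_comparison:
  fixes P :: "real \<Rightarrow> 's \<Rightarrow> 's pmf" and \<Phi> :: "'s \<Rightarrow> real"
  assumes P: "markov_semigroup P" and rates: "has_jump_rates P q r"
    and fin: "\<And>a. finite {b. b \<noteq> a \<and> q a b \<noteq> 0}"
    and r: "\<And>a. r a = (\<Sum>b | b \<noteq> a \<and> q a b \<noteq> 0. q a b)"
    and \<Phi>: "\<And>a. 0 \<le> \<Phi> a" "\<And>c. finite {a. \<Phi> a \<le> c}"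
    and drift: "\<And>a. generator q \<Phi> a \<le> K * \<Phi> a"
    and coupling: "\<And>h1 h2 a b. rel a b \<Longrightarrow>
        (\<And>a' b'. rel a' b' \<Longrightarrow> h1 a - h2 b \<le> h1 a' - h2 b') \<Longrightarrow>
        generator q h2 b \<le> generator q h1 a"
    and f1: "\<And>b. 0 \<le> f1 b" "\<And>b. f1 b \<le> 1" and f2: "\<And>b. 0 \<le> f2 b" "\<And>b. f2 b \<le> 1"
    and ordered: "\<And>a b. rel a b \<Longrightarrow> f2 b \<le> f1 a"
    and rel: "rel a b" and t: "0 \<le> t"
  shows "semigroup_apply P f2 t b \<le> semigroup_apply P f1 t a"
proof -
  \<comment> \<open>The growth rate is made positive, so that the penalty increases strictly even where \<open>\<Phi>\<close> vanishes.\<close>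
  define L where "L = max K 1"
  have L: "0 < L" by (simp add: L_def)
  have drift: "generator q \<Phi> a \<le> L * \<Phi> a" for a
    using drift[of a] mult_right_mono[OF _ \<Phi>(1), of K L a] by (simp add: L_def)
  define w where "w e t = (\<lambda>(a, b).
      semigroup_apply P f1 t a - semigroup_apply P f2 t b + e * exp (L * t) * (1 + \<Phi> a + \<Phi> b))" for e t
  have nonneg: "0 \<le> w e t (a, b)" if e: "0 < e" for e
  proof -
    define S where "S = {(a, b). rel a b \<and> e * (1 + \<Phi> a + \<Phi> b) \<le> 1}"
    have outside: "0 \<le> w e t p" if "case p of (a, b) \<Rightarrow> rel a b" "p \<notin> S" "0 \<le> t" for t p
    proof -
      obtain a b where p: "p = (a, b)" by force
      \<comment> \<open>Off \<open>S\<close> the penalty exceeds one, which is the most that the difference can fall below zero.\<close>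
      have "1 * 1 \<le> exp (L * t) * (e * (1 + \<Phi> a + \<Phi> b))"
        by (rule mult_mono) (use that L p in \<open>auto simp: S_def\<close>)
      then show ?thesis
        using semigroup_apply_bounds(1)[of f1 P t a, OF f1] semigroup_apply_bounds(2)[of f2 P t b, OF f2]
        by (simp add: w_def p mult_ac)
    qed
    have finS: "finite S"
    proof (rule finite_subset)
      show "S \<subseteq> {a. \<Phi> a \<le> 1 / e} \<times> {a. \<Phi> a \<le> 1 / e}"
      proof clarify
        fix a b assume "(a, b) \<in> S"
        then have "1 + \<Phi> a + \<Phi> b \<le> 1 / e"
          using e by (simp add: S_def pos_le_divide_eq mult.commute)
        then show "a \<in> {a. \<Phi> a \<le> 1 / e} \<and> b \<in> {a. \<Phi> a \<le> 1 / e}"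
          using \<Phi>(1)[of a] \<Phi>(1)[of b] by simp
      qed
    qed (use \<Phi>(2) in simp)
    have inside: "0 \<le> w e t p" if "p \<in> S" "0 \<le> t" for p t
      using finS _ _ _ that
    proof (rule nonneg_if_nondecreasing_at_zeros)
      fix p assume "p \<in> S"
      then obtain a b where p: "p = (a, b)" "rel a b" by (auto simp: S_def)
      show "continuous_on {0..} (\<lambda>t. w e t p)"
        unfolding w_def p prod.case
        by (intro continuous_intros semigroup_apply_continuous[OF P rates] f1 f2)
      have "0 \<le> e * exp (L * 0) * (1 + \<Phi> a + \<Phi> b)"
        using e \<Phi>(1)[of a] \<Phi>(1)[of b] by simp
      moreover have "f2 b \<le> f1 a" using ordered p by blast
      ultimately show "0 \<le> w e 0 p"
        using P by (simp add: w_def p semigroup_apply_def markov_semigroup_def)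
    next
      fix t p assume t: "0 \<le> t" and pS: "p \<in> S" and zero: "w e t p = 0"
        and min: "\<And>p'. p' \<in> S \<Longrightarrow> 0 \<le> w e t p'"
      obtain a b where p: "p = (a, b)" and rel: "rel a b" using pS by (auto simp: S_def)
      define c where "c = e * exp (L * t)"
      have c: "0 < c" using e by (simp add: c_def)
      have min': "0 \<le> w e t (a', b')" if "rel a' b'" for a' b'
        using min[of "(a', b')"] outside[of "(a', b')" t] that t by auto
      \<comment> \<open>The penalty is split between the two arguments, with opposite signs, so that the pair
        \<open>(a, b)\<close>, where \<open>w\<close> is minimal, becomes a minimum for a difference \<open>h1 a - h2 b\<close>.\<close>
      have "generator q (\<lambda>b. semigroup_apply P f2 t b + (- c) * \<Phi> b) b
          \<le> generator q (\<lambda>b. semigroup_apply P f1 t b + c * \<Phi> b) a"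
      proof (rule coupling[OF rel])
        fix a' b' assume "rel a' b'"
        from min'[OF this] zero
        show "semigroup_apply P f1 t a + c * \<Phi> a - (semigroup_apply P f2 t b + (- c) * \<Phi> b)
          \<le> semigroup_apply P f1 t a' + c * \<Phi> a' - (semigroup_apply P f2 t b' + (- c) * \<Phi> b')"
          by (simp add: w_def p c_def algebra_simps)
      qed
      then have G: "generator q (semigroup_apply P f2 t) b - c * generator q \<Phi> b
          \<le> generator q (semigroup_apply P f1 t) a + c * generator q \<Phi> a"
        by (simp only: generator_affine)
      have "c * generator q \<Phi> a + c * generator q \<Phi> b \<le> c * (L * \<Phi> a) + c * (L * \<Phi> b)"
        using c drift by (intro add_mono mult_left_mono) auto
      with G have pos: "0 < generator q (semigroup_apply P f1 t) a - generator q (semigroup_apply P f2 t) b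
          + c * L * (1 + \<Phi> a + \<Phi> b)"
        using mult_pos_pos[OF c L] by (simp add: algebra_simps)
      have "((\<lambda>t. w e t p) has_real_derivative
          generator q (semigroup_apply P f1 t) a - generator q (semigroup_apply P f2 t) b
          + c * L * (1 + \<Phi> a + \<Phi> b)) (at_right t)"
        unfolding w_def p prod.case c_def
        by (auto intro!: derivative_eq_intros
            semigroup_apply_backward_equation[OF P rates fin r f1 t]
            semigroup_apply_backward_equation[OF P rates fin r f2 t])
      from has_real_derivative_pos_inc_right[OF this pos] obtain d where
        d: "d > 0" "\<And>h. h > 0 \<Longrightarrow> h < d \<Longrightarrow> w e t p < w e (t + h) p"
        by auto
      show "\<forall>\<^sub>F s in at_right t. 0 \<le> w e s p"
        unfolding eventually_at_right_field
      proof (intro exI[of _ "t + d"] conjI allI impI)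
        fix s assume "t < s" "s < t + d"
        then show "0 \<le> w e s p" using d(2)[of "s - t"] zero by simp
      qed (use d in simp)
    qed
    show ?thesis
      using inside[of "(a, b)" t] outside[of "(a, b)" t] rel t by blast
  qed
  have "((\<lambda>e. w e t (a, b)) \<longlongrightarrow> semigroup_apply P f1 t a - semigroup_apply P f2 t b) (at_right 0)"
    unfolding w_def prod.case by (auto intro!: tendsto_eq_intros)
  then have "0 \<le> semigroup_apply P f1 t a - semigroup_apply P f2 t b"
    by (rule tendsto_lowerbound)
      (use nonneg in \<open>auto simp: eventually_at_right_field intro: exI[of _ 1]\<close>)
  then show ?thesis by simp
qed

section \<open>The generator of the branching random walk\<close>

definition neighbors :: "int ^ 'd \<Rightarrow> (int ^ 'd::finite) set" where
  "neighbors z = {z'. l1_dist z z' = 1}"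

lemma l1_dist_commute: "l1_dist x y = l1_dist y x"
  by (simp add: l1_dist_def abs_minus_commute)

lemma l1_dist_triangle: "l1_dist x z \<le> l1_dist x y + l1_dist y z"
  unfolding l1_dist_def sum.distrib[symmetric] by (rule sum_mono) linarith

lemma l1_dist_nonneg: "0 \<le> l1_dist x y"
  by (simp add: l1_dist_def sum_nonneg)

lemma abs_component_le_l1_dist: "\<bar>x $ i - y $ i\<bar> \<le> l1_dist x y"
  unfolding l1_dist_def by (rule member_le_sum) auto

lemma finite_l1_ball: "finite {z :: int ^ 'd::finite. l1_dist z 0 \<le> c}"
proof (rule finite_subset)
  show "{z :: int ^ 'd. l1_dist z 0 \<le> c} \<subseteq> vec_lambda ` (UNIV \<rightarrow>\<^sub>E {- c..c})"
  proof
    fix z :: "int ^ 'd" assume "z \<in> {z. l1_dist z 0 \<le> c}"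
    then have "vec_nth z \<in> UNIV \<rightarrow>\<^sub>E {- c..c}"
      using abs_component_le_l1_dist[of z _ 0] by (auto simp: abs_le_iff) (smt (verit))+
    then show "z \<in> vec_lambda ` (UNIV \<rightarrow>\<^sub>E {- c..c})"
      by (rule rev_image_eqI) simp
  qed
qed (intro finite_imageI finite_PiE; simp)

lemma neighbors_translate: "neighbors (z :: int ^ 'd::finite) = (+) z ` neighbors 0"
proof -
  have "z' \<in> (+) z ` neighbors 0" if "z' \<in> neighbors z" for z'
    using that by (intro image_eqI[of _ _ "z' - z"]) (auto simp: neighbors_def l1_dist_def abs_minus_commute)
  then show ?thesis by (auto simp: neighbors_def l1_dist_def)
qed

lemma finite_neighbors: "finite (neighbors (z :: int ^ 'd::finite))"
proof -
  have "neighbors 0 \<subseteq> {z :: int ^ 'd. l1_dist z 0 \<le> 1}"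
    by (auto simp: neighbors_def l1_dist_commute)
  from finite_subset[OF this finite_l1_ball] show ?thesis
    by (subst neighbors_translate[of z]) simp
qed

lemma card_neighbors: "card (neighbors (z :: int ^ 'd::finite)) = card (neighbors (0 :: int ^ 'd))"
  by (subst neighbors_translate[of z]) (simp add: card_image)

text \<open>
  Writing the generator as a sum of these contributions lets two configurations be compared
  particle by particle.
\<close>

definition particle_generator ::
  "real \<Rightarrow> ('d::finite config \<Rightarrow> real) \<Rightarrow> 'd config \<Rightarrow> int ^ 'd \<Rightarrow> real" where
  "particle_generator lam h A z =
     (h (A - {#z#}) - h A) + lam * (\<Sum>z'\<in>neighbors z. h (add_mset z' A) - h A)"

lemma sum_mset_eq_sum_count:
  fixes f :: "'b \<Rightarrow> real"
  assumes "finite S" "set_mset A \<subseteq> S"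
  shows "(\<Sum>z\<in>#A. f z) = (\<Sum>z\<in>S. real (count A z) * f z)"
  using assms(2)
proof (induction A)
  case (add z A)
  have "(\<Sum>x\<in>S. real (count (add_mset z A) x) * f x)
      = (\<Sum>x\<in>S. real (count A x) * f x + (if x = z then f x else 0))"
    by (intro sum.cong) (auto simp: algebra_simps)
  also have "\<dots> = (\<Sum>x\<in>S. real (count A x) * f x) + f z"
    using add.prems assms(1) by (simp add: sum.distrib)
  finally show ?case using add by simp
qed simp

text \<open>
  The rates are indexed by target configurations and the right-hand side by particles. The
  translation uses that neither a death nor a birth leaves the configuration unchanged, that
  distinct sites give distinct targets, and that the birth rate at a site is a sum over its
  neighbors, so that the order of summation can be exchanged.
\<close>

lemma sum_jump_rate:
  fixes A :: "('d::finite) config" and g :: "'d config \<Rightarrow> real"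
  shows "finite {B. B \<noteq> A \<and> jump_rate lam A B \<noteq> 0}"
    and "(\<Sum>B | B \<noteq> A \<and> jump_rate lam A B \<noteq> 0. jump_rate lam A B * g B)
       = (\<Sum>z\<in>#A. g (A - {#z#}) + lam * (\<Sum>z'\<in>neighbors z. g (add_mset z' A)))"
proof -
  define death where "death B = (\<Sum>x | A = add_mset x B. real (count A x))" for B
  define pressure where "pressure x = (\<Sum>y | l1_dist y x = 1. real (count A y))" for x
  define birth where "birth B = (\<Sum>x | B = add_mset x A. lam * pressure x)" for B
  define N where "N = (\<Union>y\<in>set_mset A. neighbors y)"
  define D where "D = (\<lambda>x. A - {#x#}) ` set_mset A"
  define E where "E = (\<lambda>x. add_mset x A) ` N"
  have rate: "jump_rate lam A B = death B + birth B" for B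
    by (simp add: jump_rate_def death_def birth_def pressure_def)
  have N: "finite N" by (simp add: N_def finite_neighbors)
  have fin: "finite (D \<union> E)" using N by (simp add: D_def E_def)
  have pressure0: "pressure x = 0" if "x \<notin> N" for x
    unfolding pressure_def
    by (intro sum.neutral) (use that in \<open>auto simp: N_def neighbors_def count_eq_zero_iff\<close>)
  have death: "death (A - {#x#}) = real (count A x)" if "x \<in># A" for x
  proof -
    have "add_mset x C = add_mset x' C \<longleftrightarrow> x = x'" for x' and C :: "'d config" by auto
    then have "{x'. A = add_mset x' (A - {#x#})} = {x}"
      using insert_DiffM[OF that] by (metis (mono_tags, lifting) Collect_cong singleton_conv2)
    then show ?thesis by (simp add: death_def)
  qed
  have death0: "death B = 0" if "B \<notin> D" for B
    unfolding death_def
    by (rule sum.neutral) (use that in \<open>force simp: D_def\<close>)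
  have birth: "birth (add_mset x A) = lam * pressure x" for x
  proof -
    have "{x'. add_mset x A = add_mset x' A} = {x}" by auto
    then show ?thesis by (simp add: birth_def)
  qed
  have birth0: "birth B = 0" if "B \<notin> E" for B
    unfolding birth_def
    by (rule sum.neutral) (use that pressure0 in \<open>force simp: E_def\<close>)
  have notin: "A \<notin> D \<union> E"
  proof -
    have "size B \<noteq> size A" if "B \<in> D \<union> E" for B
      using that by (auto simp: D_def E_def size_Diff_singleton dest: multi_member_split)
    then show ?thesis by blast
  qed
  have sub: "{B. B \<noteq> A \<and> jump_rate lam A B \<noteq> 0} \<subseteq> D \<union> E"
  proof
    fix B assume "B \<in> {B. B \<noteq> A \<and> jump_rate lam A B \<noteq> 0}"
    then have "death B \<noteq> 0 \<or> birth B \<noteq> 0" by (auto simp: rate)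
    then show "B \<in> D \<union> E" using death0 birth0 by blast
  qed
  then show "finite {B. B \<noteq> A \<and> jump_rate lam A B \<noteq> 0}"
    using fin finite_subset by blast
  have "(\<Sum>B | B \<noteq> A \<and> jump_rate lam A B \<noteq> 0. jump_rate lam A B * g B)
      = (\<Sum>B\<in>D \<union> E. jump_rate lam A B * g B)"
    by (rule sum.mono_neutral_left[OF fin sub]) (use notin in auto)
  also have "\<dots> = (\<Sum>B\<in>D \<union> E. death B * g B) + (\<Sum>B\<in>D \<union> E. birth B * g B)"
    by (simp add: rate distrib_right sum.distrib)
  also have "(\<Sum>B\<in>D \<union> E. death B * g B) = (\<Sum>B\<in>D. death B * g B)"
    by (rule sum.mono_neutral_right[OF fin]) (use death0 in auto)
  also have "\<dots> = (\<Sum>x\<in>set_mset A. death (A - {#x#}) * g (A - {#x#}))"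
    unfolding D_def
  proof (rule sum.reindex[unfolded o_def], rule inj_onI)
    fix x x' assume "x \<in># A" "x' \<in># A" "A - {#x#} = A - {#x'#}"
    then have "add_mset x (A - {#x#}) = add_mset x' (A - {#x#})" by (metis insert_DiffM)
    then show "x = x'" by simp
  qed
  also have "\<dots> = (\<Sum>x\<in>set_mset A. real (count A x) * g (A - {#x#}))"
    by (intro sum.cong) (simp_all add: death)
  also have "\<dots> = (\<Sum>z\<in>#A. g (A - {#z#}))"
    by (simp add: sum_mset_eq_sum_count[of "set_mset A"])
  also have "(\<Sum>B\<in>D \<union> E. birth B * g B) = (\<Sum>B\<in>E. birth B * g B)"
    by (rule sum.mono_neutral_right[OF fin]) (use birth0 in auto)
  also have "\<dots> = (\<Sum>x\<in>N. birth (add_mset x A) * g (add_mset x A))"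
    unfolding E_def by (rule sum.reindex[unfolded o_def]) (auto intro: inj_onI)
  also have "\<dots> = (\<Sum>x\<in>N. lam * pressure x * g (add_mset x A))"
    by (simp add: birth)
  also have "\<dots> = (\<Sum>x\<in>N. \<Sum>y\<in>set_mset A.
      if x \<in> neighbors y then real (count A y) * (lam * g (add_mset x A)) else 0)"
  proof (intro sum.cong refl)
    fix x assume "x \<in> N"
    have "pressure x = (\<Sum>y\<in>{y\<in>set_mset A. x \<in> neighbors y}. real (count A y))"
      unfolding pressure_def
      by (rule sum.mono_neutral_right)
        (use finite_neighbors[of x] in \<open>auto simp: neighbors_def l1_dist_commute count_eq_zero_iff\<close>)
    also have "\<dots> = (\<Sum>y\<in>set_mset A. if x \<in> neighbors y then real (count A y) else 0)"
      by (simp add: sum.inter_filter)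
    finally show "lam * pressure x * g (add_mset x A) = (\<Sum>y\<in>set_mset A.
        if x \<in> neighbors y then real (count A y) * (lam * g (add_mset x A)) else 0)"
      by (simp add: sum_distrib_left sum_distrib_right if_distrib if_distribR mult_ac cong: if_cong)
  qed
  also have "\<dots> = (\<Sum>y\<in>set_mset A. \<Sum>x\<in>N.
      if x \<in> neighbors y then real (count A y) * (lam * g (add_mset x A)) else 0)"
    by (rule sum.swap)
  also have "\<dots> = (\<Sum>y\<in>set_mset A. real (count A y) * (lam * (\<Sum>x\<in>neighbors y. g (add_mset x A))))"
  proof (intro sum.cong refl)
    fix y assume y: "y \<in># A"
    have "{x \<in> N. x \<in> neighbors y} = neighbors y" using y by (auto simp: N_def)
    then show "(\<Sum>x\<in>N. if x \<in> neighbors y then real (count A y) * (lam * g (add_mset x A)) else 0)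
        = real (count A y) * (lam * (\<Sum>x\<in>neighbors y. g (add_mset x A)))"
      using N by (simp add: sum.inter_filter[symmetric] sum_distrib_left)
  qed
  also have "\<dots> = (\<Sum>z\<in>#A. lam * (\<Sum>z'\<in>neighbors z. g (add_mset z' A)))"
    by (simp add: sum_mset_eq_sum_count[of "set_mset A"])
  finally show "(\<Sum>B | B \<noteq> A \<and> jump_rate lam A B \<noteq> 0. jump_rate lam A B * g B)
       = (\<Sum>z\<in>#A. g (A - {#z#}) + lam * (\<Sum>z'\<in>neighbors z. g (add_mset z' A)))"
    by (simp add: sum_mset.distrib)
qed

lemma generator_jump_rate:
  "generator (jump_rate lam) h A = (\<Sum>z\<in>#A. particle_generator lam h A z)"
  using sum_jump_rate(2)[of lam A "\<lambda>B. h B - h A"]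
  by (simp add: generator_def particle_generator_def)

lemma total_jump_rate_eq_sum:
  "total_jump_rate lam A = (\<Sum>B | B \<noteq> A \<and> jump_rate lam A B \<noteq> 0. jump_rate lam A B)"
proof -
  have "total_jump_rate lam A = (\<Sum>\<^sub>\<infinity>B\<in>{B. B \<noteq> A \<and> jump_rate lam A B \<noteq> 0}. jump_rate lam A B)"
    unfolding total_jump_rate_def by (rule infsum_cong_neutral) auto
  then show ?thesis using sum_jump_rate(1)[of A lam] by simp
qed

text \<open>
  The Lyapunov function. Counting the particles alone would control the growth but would leave
  infinitely many configurations below each level, since particles can sit anywhere; weighting
  each particle by its distance to the origin makes the level sets finite.
\<close>

definition weight :: "('d::finite) config \<Rightarrow> real" where
  "weight A = (\<Sum>z\<in>#A. 1 + real_of_int (l1_dist z 0))"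

lemma weight_nonneg: "0 \<le> weight A"
  unfolding weight_def by (induction A) (auto simp: l1_dist_nonneg)

lemma finite_weight_le: "finite {A :: ('d::finite) config. weight A \<le> c}"
proof (rule finite_subset)
  let ?Z = "{z :: int ^ 'd. l1_dist z 0 \<le> \<lfloor>c\<rfloor>}"
  have size: "real (size A) \<le> weight A" for A :: "'d config"
    unfolding weight_def by (induction A) (simp_all add: add_increasing l1_dist_nonneg)
  have site: "real_of_int (l1_dist z 0) \<le> weight A" if z: "z \<in># A" for z and A :: "'d config"
  proof -
    obtain B where "A = add_mset z B" using multi_member_split[OF z] by blast
    then show ?thesis using weight_nonneg[of B] by (simp add: weight_def)
  qed
  show "{A :: 'd config. weight A \<le> c} \<subseteq> (\<Union>n\<le>nat \<lfloor>c\<rfloor>. multisets_of_size ?Z n)"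
  proof
    fix A :: "'d config" assume "A \<in> {A. weight A \<le> c}"
    then have "A \<in> multisets_of_size ?Z (size A)" "size A \<le> nat \<lfloor>c\<rfloor>"
      using size[of A] site[of _ A]
      by (force simp: multisets_of_size_def le_floor_iff) (use size[of A] \<open>A \<in> {A. weight A \<le> c}\<close> in \<open>simp add: le_nat_floor\<close>)
    then show "A \<in> (\<Union>n\<le>nat \<lfloor>c\<rfloor>. multisets_of_size ?Z n)" by blast
  qed
qed (auto intro: finite_l1_ball)

text \<open>
  Deaths only lower the weight. A child sits one step away from its parent, so its weight is at
  most twice that of the parent.
\<close>

lemma generator_weight_le:
  assumes lam: "0 \<le> lam"
  shows "generator (jump_rate lam) weight A
      \<le> 2 * lam * real (card (neighbors (0 :: int ^ 'd))) * weight (A :: ('d::finite) config)"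
proof -
  define n where "n = real (card (neighbors (0 :: int ^ 'd)))"
  define c where "c z = 1 + real_of_int (l1_dist z 0)" for z :: "int ^ 'd"
  have w: "weight (add_mset z A) = c z + weight A" for z A by (simp add: weight_def c_def)
  have w': "weight (A - {#z#}) \<le> weight A" if "z \<in># A" for z
    using that w[of z "A - {#z#}"] l1_dist_nonneg[of z 0] by (simp add: c_def)
  have "particle_generator lam weight A z \<le> 2 * lam * n * c z" if z: "z \<in># A" for z
  proof -
    have "(\<Sum>z'\<in>neighbors z. weight (add_mset z' A) - weight A) \<le> (\<Sum>z'\<in>neighbors z. 2 * c z)"
    proof (rule sum_mono)
      fix z' assume "z' \<in> neighbors z"
      then have "l1_dist z' 0 \<le> 1 + l1_dist z 0"
        using l1_dist_triangle[of z' 0 z] by (simp add: neighbors_def l1_dist_commute)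
      then show "weight (add_mset z' A) - weight A \<le> 2 * c z"
        using l1_dist_nonneg[of z 0] by (simp add: w c_def)
    qed
    also have "\<dots> = n * (2 * c z)" by (simp add: card_neighbors[of z] n_def)
    finally have "lam * (\<Sum>z'\<in>neighbors z. weight (add_mset z' A) - weight A) \<le> lam * (n * (2 * c z))"
      by (rule mult_left_mono[OF _ lam])
    then show ?thesis using w'[OF z] by (simp add: particle_generator_def algebra_simps)
  qed
  then have "generator (jump_rate lam) weight A \<le> (\<Sum>z\<in>#A. 2 * lam * n * c z)"
    unfolding generator_jump_rate by (rule sum_mset_mono)
  also have "\<dots> = 2 * lam * n * weight A"
    by (simp add: weight_def c_def sum_mset_distrib_left)
  finally show ?thesis by (simp add: n_def)
qed

section \<open>Reflection coupling\<close>

text \<open>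
  Reflection in the hyperplane where the \<open>i\<close>-th coordinate equals \<open>s / 2\<close>. For odd \<open>s\<close> it has no
  fixed sites.
\<close>

definition reflect :: "'d \<Rightarrow> int \<Rightarrow> int ^ 'd \<Rightarrow> int ^ ('d::finite)" where
  "reflect i s z = (\<chi> j. if j = i then s - z $ j else z $ j)"

lemma reflect_reflect [simp]: "reflect i s (reflect i s z) = z"
  by (simp add: reflect_def vec_eq_iff)

lemma inj_reflect: "inj_on (reflect i s) S"
  by (metis inj_onI reflect_reflect)

lemma count_image_mset_reflect:
  "count (image_mset (reflect i s) C) (reflect i s x) = count C x"
  by (induction C) (auto dest: inj_onD[OF inj_reflect])

lemma l1_dist_reflect: "l1_dist (reflect i s y) (reflect i s z) = l1_dist y z"
  unfolding l1_dist_def by (rule sum.cong) (auto simp: reflect_def)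

lemma neighbors_reflect: "neighbors (reflect i s z) = reflect i s ` neighbors z"
proof -
  have "z' \<in> reflect i s ` neighbors z" if "z' \<in> neighbors (reflect i s z)" for z'
  proof (rule image_eqI[of _ _ "reflect i s z'"])
    show "reflect i s z' \<in> neighbors z"
      using that l1_dist_reflect[of i s "reflect i s z" z'] by (simp add: neighbors_def)
  qed simp
  then show ?thesis by (auto simp: neighbors_def l1_dist_reflect)
qed

text \<open>
  A nearest-neighbor step that leaves the open half-space moves only the \<open>i\<close>-th coordinate. It
  ends on the hyperplane if \<open>s\<close> is even, and at the mirror image of its starting point if \<open>s\<close> is
  odd.
\<close>

lemma neighbor_crossing:
  assumes z': "z' \<in> neighbors z" and z: "2 * z $ i < s" "\<not> 2 * z' $ i < s"
  shows "reflect i s z' = z' \<or> reflect i s z' = z"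
proof -
  have d: "(\<Sum>j\<in>UNIV. \<bar>z $ j - z' $ j\<bar>) = 1"
    using z' by (simp add: neighbors_def l1_dist_def)
  have split: "(\<Sum>j\<in>UNIV. \<bar>z $ j - z' $ j\<bar>)
      = \<bar>z $ i - z' $ i\<bar> + (\<Sum>j\<in>UNIV - {i}. \<bar>z $ j - z' $ j\<bar>)"
    by (rule sum.remove) auto
  have "0 \<le> (\<Sum>j\<in>UNIV - {i}. \<bar>z $ j - z' $ j\<bar>)" by (rule sum_nonneg) simp
  with d split z have i: "z' $ i = z $ i + 1"
    and "(\<Sum>j\<in>UNIV - {i}. \<bar>z $ j - z' $ j\<bar>) = 0" by linarith+
  then have j: "z $ j = z' $ j" if "j \<noteq> i" for j
    using that by (simp add: sum_nonneg_eq_0_iff)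
  have "s = 2 * z' $ i \<or> s = z' $ i + z $ i"
    using i z by linarith
  then show ?thesis
    using j by (auto simp: reflect_def vec_eq_iff)
qed

text \<open>
  The particles in \<open>C\<close> are opposed to their mirror images, and those in \<open>D\<close> to themselves. Initially
  the only particle is in \<open>D\<close>; \<open>C\<close> starts to fill when the hyperplane is reached. As \<open>D\<close> stays
  in the open half-space, the second configuration has at the mirror image of a site \<open>x\<close> of the
  closed half-space only the mirror images of the particles of \<open>C\<close> at \<open>x\<close>.
\<close>

definition mirror_coupled :: "'d \<Rightarrow> int \<Rightarrow> ('d::finite) config \<Rightarrow> 'd config \<Rightarrow> bool" where
  "mirror_coupled i s A B \<longleftrightarrow>
     (\<exists>C D. A = C + D \<and> B = image_mset (reflect i s) C + D \<and> (\<forall>z\<in>#D. 2 * z $ i < s))"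

lemma mirror_coupledI:
  assumes "A = C + D" "B = image_mset (reflect i s) C + D" "\<And>z. z \<in># D \<Longrightarrow> 2 * z $ i < s"
  shows "mirror_coupled i s A B"
  using assms unfolding mirror_coupled_def by blast

text \<open>
  Every possible transition is matched with one that keeps the pair related. A particle of \<open>C\<close> and
  its mirror image die together and have mirrored children; a particle of \<open>D\<close> and its copy die
  together and have the same children. The delicate case is a particle of \<open>D\<close> at \<open>z\<close> whose child
  leaves the open half-space. If the child is born on the hyperplane, it is its own mirror image
  and belongs to \<open>C\<close>. Otherwise it is born at the mirror image of \<open>z\<close>; then parent and child are
  exchanged by the reflection, and both can be put in \<open>C\<close>.
\<close>

lemma mirror_coupled_generator_mono:
  assumes rel: "mirror_coupled i s A B" and lam: "0 \<le> lam"
    and min: "\<And>A' B'. mirror_coupled i s A' B' \<Longrightarrow> h1 A - h2 B \<le> h1 A' - h2 B'"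
  shows "generator (jump_rate lam) h2 B \<le> generator (jump_rate lam) h1 A"
proof -
  define R where "R = reflect i s"
  obtain C D where A: "A = C + D" and B: "B = image_mset R C + D"
    and D: "\<And>z. z \<in># D \<Longrightarrow> 2 * z $ i < s"
    using rel unfolding mirror_coupled_def R_def by blast
  have step: "h2 B' - h2 B \<le> h1 A' - h1 A"
    if "A' = C' + D'" "B' = image_mset R C' + D'" "\<And>z. z \<in># D' \<Longrightarrow> 2 * z $ i < s" for A' B' C' D'
    using min[OF mirror_coupledI[of A' C' D' B' i s]] that by (simp add: R_def)
  have common: "particle_generator lam h2 B (R z) \<le> particle_generator lam h1 A z" if z: "z \<in># C" for z
  proof -
    obtain C' where C: "C = add_mset z C'" using multi_member_split[OF z] by blast
    have "h2 (B - {#R z#}) - h2 B \<le> h1 (A - {#z#}) - h1 A"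
      by (rule step[of _ C' D]) (use D in \<open>auto simp: A B C\<close>)
    moreover have "(\<Sum>z'\<in>neighbors (R z). h2 (add_mset z' B) - h2 B)
        = (\<Sum>z'\<in>neighbors z. h2 (add_mset (R z') B) - h2 B)"
      unfolding R_def neighbors_reflect by (rule sum.reindex[unfolded o_def]) (rule inj_reflect)
    moreover have "\<dots> \<le> (\<Sum>z'\<in>neighbors z. h1 (add_mset z' A) - h1 A)"
    proof (rule sum_mono)
      fix z'
      show "h2 (add_mset (R z') B) - h2 B \<le> h1 (add_mset z' A) - h1 A"
        by (rule step[of _ "add_mset z' C" D]) (use D in \<open>auto simp: A B\<close>)
    qed
    ultimately show ?thesis
      unfolding particle_generator_def using lam by (intro add_mono mult_left_mono) auto
  qed
  have discrepant: "particle_generator lam h2 B z \<le> particle_generator lam h1 A z" if z: "z \<in># D" for z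
  proof -
    obtain D' where D': "D = add_mset z D'" using multi_member_split[OF z] by blast
    have "h2 (B - {#z#}) - h2 B \<le> h1 (A - {#z#}) - h1 A"
      by (rule step[of _ C D']) (use D in \<open>auto simp: A B D'\<close>)
    moreover have "(\<Sum>z'\<in>neighbors z. h2 (add_mset z' B) - h2 B)
        \<le> (\<Sum>z'\<in>neighbors z. h1 (add_mset z' A) - h1 A)"
    proof (rule sum_mono)
      fix z' assume z': "z' \<in> neighbors z"
      consider "2 * z' $ i < s" | "R z' = z'" | "R z' = z"
        using neighbor_crossing[OF z' D[OF z]] unfolding R_def by blast
      then show "h2 (add_mset z' B) - h2 B \<le> h1 (add_mset z' A) - h1 A"
      proof cases
        case 1
        then show ?thesis
          by (intro step[of _ C "add_mset z' D"]) (use D in \<open>auto simp: A B\<close>)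
      next
        case 2
        then show ?thesis
          by (intro step[of _ "add_mset z' C" D]) (use D in \<open>auto simp: A B\<close>)
      next
        case 3
        \<comment> \<open>The parent leaves \<open>D\<close>: as a pair, parent and child are invariant under the reflection.\<close>
        then have "R z = z'" by (metis R_def reflect_reflect)
        with 3 show ?thesis
          by (intro step[of _ "add_mset z (add_mset z' C)" D']) (use D in \<open>auto simp: A B D'\<close>)
      qed
    qed
    ultimately show ?thesis
      unfolding particle_generator_def using lam by (intro add_mono mult_left_mono) auto
  qed
  have "generator (jump_rate lam) h2 B
      = (\<Sum>z\<in>#C. particle_generator lam h2 B (R z)) + (\<Sum>z\<in>#D. particle_generator lam h2 B z)"
    unfolding generator_jump_rate by (subst (1) B) (simp add: image_mset.compositionality o_def)
  also have "\<dots> \<le> (\<Sum>z\<in>#C. particle_generator lam h1 A z) + (\<Sum>z\<in>#D. particle_generator lam h1 A z)"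
    by (intro add_mono sum_mset_mono common discrepant)
  also have "\<dots> = generator (jump_rate lam) h1 A"
    unfolding generator_jump_rate by (subst (3) A) simp
  finally show ?thesis .
qed

text \<open>
  The two sides are compared for the same initial configuration. That the origin lies in the open
  half-space makes this configuration related to itself.
\<close>

lemma occupation_reflect_le:
  fixes P :: "real \<Rightarrow> ('d::finite) config \<Rightarrow> 'd config pmf"
  assumes P: "markov_semigroup P" "has_jump_rates P (jump_rate lam) (total_jump_rate lam)"
    and lam: "0 \<le> lam" and t: "0 \<le> t" and s: "0 < s" and x: "2 * x $ i \<le> s"
  shows "measure (P t {#0#}) {A. c < real (count A (reflect i s x))}
       \<le> measure (P t {#0#}) {A. c < real (count A x)}"
proof -
  define U where "U y = {A :: 'd config. c < real (count A y)}" for y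
  have "semigroup_apply P (indicator (U (reflect i s x))) t {#0#} \<le> semigroup_apply P (indicator (U x)) t {#0#}"
  proof (rule stochastic_comparison[where rel = "mirror_coupled i s", OF P sum_jump_rate(1)
        total_jump_rate_eq_sum weight_nonneg finite_weight_le generator_weight_le[OF lam]])
    fix A B :: "'d config" assume "mirror_coupled i s A B"
    then obtain C D where A: "A = C + D" and B: "B = image_mset (reflect i s) C + D"
      and D: "\<And>z. z \<in># D \<Longrightarrow> 2 * z $ i < s"
      unfolding mirror_coupled_def by blast
    have "reflect i s x \<notin># D"
      using D[of "reflect i s x"] x by (auto simp: reflect_def)
    then have "count B (reflect i s x) \<le> count A x"
      by (simp add: A B count_image_mset_reflect not_in_iff)
    then show "indicator (U (reflect i s x)) B \<le> (indicator (U x) A :: real)"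
      by (auto simp: U_def indicator_def)
  next
    show "mirror_coupled i s {#0#} {#0#}"
      by (rule mirror_coupledI[of _ "{#}" "{#0#}"]) (use s in auto)
  next
    show "generator (jump_rate lam) h2 B \<le> generator (jump_rate lam) h1 A"
      if "mirror_coupled i s A B"
        and "\<And>A' B'. mirror_coupled i s A' B' \<Longrightarrow> h1 A - h2 B \<le> h1 A' - h2 B'" for h1 h2 A B
      by (rule mirror_coupled_generator_mono[OF that(1) lam]) (rule that(2))
  qed (use t in \<open>auto simp: indicator_def\<close>)
  then show ?thesis by (simp add: semigroup_apply_def U_def)
qed

section \<open>One-dimensional laws\<close>

text \<open>
  The Markov property at time zero, integrated over the probability space.
\<close>

lemma markov_process_law:
  fixes Z :: "real \<Rightarrow> 'w \<Rightarrow> 's"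
  assumes count: "countable (UNIV :: 's set)" and Z: "markov_process M Z P"
    and Z0: "AE \<omega> in M. Z 0 \<omega> = a" and t: "0 \<le> t"
  shows "distr M (count_space UNIV) (Z t) = measure_pmf (P t a)"
proof (rule measure_eqI_countable[where A = UNIV])
  interpret prob_space M using Z by (simp add: markov_process_def)
  have meas [measurable]: "Z u \<in> measurable M (count_space UNIV)" if "0 \<le> u" for u
    using Z that by (simp add: markov_process_def)
  have past: "subalgebra M (past M Z 0)"
  proof -
    have "{Z u -` B \<inter> space M |u B. 0 \<le> u \<and> u \<le> 0} \<subseteq> sets M"
      by (auto intro!: measurable_sets[OF meas])
    moreover from this have "{Z u -` B \<inter> space M |u B. 0 \<le> u \<and> u \<le> 0} \<subseteq> Pow (space M)"
      using sets.space_closed by blast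
    ultimately show ?thesis
      unfolding past_def subalgebra_def
      by (simp add: space_measure_of_conv sets_measure_of sets.sigma_sets_subset)
  qed
  interpret sigma_finite_subalgebra M "past M Z 0"
    by (rule finite_measure_subalgebra_is_sigma_finite)
       (simp add: finite_measure_subalgebra_def finite_measure_subalgebra_axioms_def past finite_measure_axioms)
  fix b
  define X where "X = {\<omega> \<in> space M. Z t \<omega> = b}"
  have X: "X \<in> sets M" unfolding X_def using meas[OF t] by measurable
  have "AE \<omega> in M. real_cond_exp M (past M Z 0) (indicator X) \<omega> = pmf (P t (Z 0 \<omega>)) b"
  proof -
    have "AE \<omega> in M. real_cond_exp M (past M Z 0) (indicator {\<omega> \<in> space M. Z (0 + t) \<omega> = b}) \<omega>
        = pmf (P t (Z 0 \<omega>)) b"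
      using Z t unfolding markov_process_def by blast
    then show ?thesis by (simp add: X_def)
  qed
  then have ae: "AE \<omega> in M. real_cond_exp M (past M Z 0) (indicator X) \<omega> = pmf (P t a) b"
    using Z0 by eventually_elim simp
  have "prob X = (\<integral>\<omega>. indicator X \<omega> \<partial>M)" using X by simp
  also have "\<dots> = (\<integral>\<omega>. real_cond_exp M (past M Z 0) (indicator X) \<omega> \<partial>M)"
    by (intro real_cond_exp_int(2)[symmetric] integrable_const_bound[where B = 1])
      (use X in \<open>auto simp: indicator_def\<close>)
  also have "\<dots> = (\<integral>\<omega>. pmf (P t a) b \<partial>M)"
    by (rule integral_cong_AE) (use ae in auto)
  also have "\<dots> = pmf (P t a) b" by (simp add: prob_space)
  finally have "prob X = pmf (P t a) b" .
  moreover have "Z t -` {b} \<inter> space M = X" by (auto simp: X_def)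
  ultimately show "emeasure (distr M (count_space UNIV) (Z t)) {b} = emeasure (P t a) {b}"
    using meas[OF t] by (simp add: emeasure_distr emeasure_eq_measure emeasure_pmf_single)
qed (use count in auto)

lemma countable_config: "countable (UNIV :: ('d::finite) config set)"
  by (metis countableI_type countable_image surj_mset)

theorem corollary3:
  fixes lam :: real
    and M :: "'w measure"
    and \<zeta> :: "real \<Rightarrow> 'w \<Rightarrow> ('d::finite) config"
    and x y :: "int ^ 'd"
    and t :: real
  assumes "lam > 0"
    and "branching_random_walk lam M \<zeta>"
    and "AE \<omega> in M. \<zeta> 0 \<omega> = {#0#}"
    and "0 \<le> x" and "0 \<le> y"
    and "t \<ge> 0"
    and "x \<le> y"
  shows "stochastically_le M (\<lambda>\<omega>. real (count (\<zeta> t \<omega>) y)) M (\<lambda>\<omega>. real (count (\<zeta> t \<omega>) x))"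
proof -
  obtain P where P: "markov_semigroup P" "has_jump_rates P (jump_rate lam) (total_jump_rate lam)"
    and proc: "markov_process M \<zeta> P"
    using assms(2) unfolding branching_random_walk_def by blast
  define Q where "Q = measure_pmf (P t {#0#})"
  have law: "distr M (count_space UNIV) (\<zeta> t) = Q"
    unfolding Q_def by (rule markov_process_law[OF countable_config proc assms(3,6)])
  have cdf: "cdf (distr M borel (\<lambda>\<omega>. real (count (\<zeta> t \<omega>) z))) c
      = 1 - measure Q {A. c < real (count A z)}" for z c
  proof -
    have meas: "\<zeta> t \<in> measurable M (count_space UNIV)"
      using proc assms(6) by (simp add: markov_process_def)
    have "distr M borel (\<lambda>\<omega>. real (count (\<zeta> t \<omega>) z)) = distr Q borel (\<lambda>A. real (count A z))"
      unfolding law[symmetric] by (subst distr_distr) (use meas in \<open>auto simp: o_def\<close>)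
    then have "cdf (distr M borel (\<lambda>\<omega>. real (count (\<zeta> t \<omega>) z))) c
        = measure Q ((\<lambda>A. real (count A z)) -` {..c})"
      by (simp add: cdf_def measure_distr Q_def)
    also have "(\<lambda>A. real (count A z)) -` {..c} = UNIV - {A. c < real (count A z)}" by auto
    also have "measure Q \<dots> = 1 - measure Q {A. c < real (count A z)}"
      using measure_pmf.prob_compl[of "{A. c < real (count A z)}" "P t {#0#}"] by (simp add: Q_def)
    finally show ?thesis .
  qed
  \<comment> \<open>The coordinates of \<open>x\<close> are replaced by those of \<open>y\<close> one at a time. A replacement that changes the site
    is a reflection in the hyperplane halfway between the two values, which separates the origin
    from the new site.\<close>
  define swap where "swap I = (\<chi> j. if j \<in> I then y $ j else x $ j)" for I
  have "measure Q {A. c < real (count A (swap I))} \<le> measure Q {A. c < real (count A x)}" for c I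
    using finite[of I]
  proof (induction I rule: finite_induct)
    case empty
    have "swap {} = x" by (simp add: swap_def vec_eq_iff)
    then show ?case by simp
  next
    case (insert i I)
    have le: "0 \<le> x $ i" "x $ i \<le> y $ i"
      using assms(4,7) by (auto simp: less_eq_vec_def)
    have "measure Q {A. c < real (count A (swap (insert i I)))}
        \<le> measure Q {A. c < real (count A (swap I))}"
    proof (cases "x $ i = y $ i")
      case True
      then have "swap (insert i I) = swap I" by (auto simp: swap_def vec_eq_iff)
      then show ?thesis by simp
    next
      case False
      have "swap (insert i I) = reflect i (x $ i + y $ i) (swap I)"
        using insert.hyps by (auto simp: swap_def reflect_def vec_eq_iff)
      then show ?thesis
        using occupation_reflect_le[OF P _ assms(6), of "x $ i + y $ i" "swap I" i c]
          assms(1) le False insert.hyps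
        by (simp add: Q_def swap_def)
    qed
    with insert.IH show ?case by simp
  qed
  moreover have "swap UNIV = y" by (simp add: swap_def vec_eq_iff)
  ultimately show ?thesis
    unfolding stochastically_le_def cdf by (metis diff_left_mono)
qed

end
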